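(* Let $A$ and $B$ be Abelian heaps. (1) Every element of the direct sum $A\boxplus B$ is of one of the following types: (a) elements $a\in A$ and $b\in B$ (classes of one-letter words); (b) three-letter words $\langle a\,b\,b'\rangle$ and $\langle a\,a'\,b\rangle$, with $a\neq a'$ in $A$ and $b\neq b'$ in $B$; (c) alternating words $\langle a_1b_1a_2\ldots a_nb_na_{n+1}\rangle$ and $\langle b_1a_1b_2\ldots b_na_nb_{n+1}\rangle$, where $a_i\in A$ and $b_i\in B$. (2) Fix any $e_A\in A$ and $e_B\in B$. Then any of the multi-letter words in statement (1) can be written in one of the forms $$\langle a\,b\,e_B\rangle,\quad \langle b\,a\,e_A\rangle,\quad \langle a\,b\,e_Ae_B\ldots e_Ae_Be_A\rangle,\quad \langle b\,a\,e_Be_A\ldots e_Be_Ae_B\rangle,$$ with $a\in A$ and $b\in B$. In the last two forms the word ends in an alternating sequence of $e_A$'s and $e_B$'s of odd length at least one, starting and ending with $e_A$ in the third form and with $e_B$ in the fourth.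
   Context: A heap is a set $H$ with a ternary operation $[-,-,-]$ such that $[[a,b,c],d,e]=[a,b,[c,d,e]]$ and $[a,b,b]=a=[b,b,a]$ for all $a,b,c,d,e\in H$. It is Abelian if $[a,b,c]=[c,b,a]$ for all $a,b,c$. Free Abelian heap $\mathcal{A}(X)$ on a set $X$: a symmetric word is the set of all words obtained from an odd-length word $x_1y_1x_2\ldots y_nx_{n+1}$ in $X$ by arbitrarily permuting the letters $x_i$ in odd positions among themselves and the letters $y_j$ in even positions among themselves. It is reduced if none of the words in it has two equal consecutive letters. Every symmetric word can be pruned to a unique reduced one by repeatedly removing pairs of equal consecutive letters from the words in it. $\mathcal{A}(X)$ is the set of reduced symmetric words, with the ternary operation given by concatenating representatives and pruning. If $S$ is a non-empty sub-heap of an Abelian heap $H$, $H/S$ is the heap of classes of the relation $a\sim_S b$ iff $[a,b,s]\in S$ for some (equivalently all) $s\in S$, with the induced operation. Direct sum: for Abelian heaps $A,B$ with operations $[-,-,-]_A$, $[-,-,-]_B$, let $A\sqcup B$ be the disjoint union of sets, fix any $e\in\mathcal{A}(A\sqcup B)$ and let $C_e$ be the sub-heap of $\mathcal{A}(A\sqcup B)$ generated by all elements $[[a,a',a''],[a,a',a'']_A,e]$ and $[[b,b',b''],[b,b',b'']_B,e]$ with $a,a',a''\in A$, $b,b',b''\in B$, where the undecorated brackets are taken in $\mathcal{A}(A\sqcup B)$. Then $A\boxplus B:=\mathcal{A}(A\sqcup B)/C_e$ (and $A\boxplus B:=\emptyset$ if $A=B=\emptyset$). The class in $A\boxplus B$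 of the symmetric word determined by $s_1s_2\ldots s_{2n+1}$, $s_i\in A\sqcup B$, is denoted $\langle s_1s_2\ldots s_{2n+1}\rangle$; it equals the iterated heap bracket $[s_1,s_2,\ldots,s_{2n+1}]$ in $A\boxplus B$ of the classes of the one-letter words $s_i$. *)

theory Defs
  imports "HOL.Hull" "HOL-Algebra.Congruence" "HOL-Combinatorics.Permutations"
begin

section \<open>Heaps\<close>

record 'a ternary = "'a partial_object" +
  bracket :: "'a \<Rightarrow> 'a \<Rightarrow> 'a \<Rightarrow> 'a"

text \<open>The carrier of a heap may be empty.\<close>

locale heap =
  fixes H :: "('a, 'm) ternary_scheme"
  assumes bracket_closed:
      "\<lbrakk>a \<in> carrier H; b \<in> carrier H; c \<in> carrier H\<rbrakk> \<Longrightarrow> bracket H a b c \<in> carrier H"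
    and bracket_assoc:
      "\<lbrakk>a \<in> carrier H; b \<in> carrier H; c \<in> carrier H; d \<in> carrier H; e \<in> carrier H\<rbrakk> \<Longrightarrow>
        bracket H (bracket H a b c) d e = bracket H a b (bracket H c d e)"
    and bracket_right_cancel:
      "\<lbrakk>a \<in> carrier H; b \<in> carrier H\<rbrakk> \<Longrightarrow> bracket H a b b = a"
    and bracket_left_cancel:
      "\<lbrakk>a \<in> carrier H; b \<in> carrier H\<rbrakk> \<Longrightarrow> bracket H b b a = a"

locale abelian_heap = heap +
  assumes bracket_comm:
    "\<lbrakk>a \<in> carrier H; b \<in> carrier H; c \<in> carrier H\<rbrakk> \<Longrightarrow> bracket H a b c = bracket H c b a"

definition subheap :: "('a, 'm) ternary_scheme \<Rightarrow> 'a set \<Rightarrow> bool" where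
  "subheap H S \<longleftrightarrow> S \<subseteq> carrier H \<and> (\<forall>a\<in>S. \<forall>b\<in>S. \<forall>c\<in>S. bracket H a b c \<in> S)"

definition subheap_rel :: "('a, 'm) ternary_scheme \<Rightarrow> 'a set \<Rightarrow> ('a \<times> 'a) set" where
  "subheap_rel H S = {(a, b). a \<in> carrier H \<and> b \<in> carrier H \<and> (\<exists>s\<in>S. bracket H a b s \<in> S)}"

text \<open>The union in the bracket is the usual lifting to equivalence classes; for a non-empty
  sub-heap of an Abelian heap all the united classes coincide.\<close>

definition quotient_heap :: "('a, 'm) ternary_scheme \<Rightarrow> 'a set \<Rightarrow> 'a set ternary" where
  "quotient_heap H S =
    \<lparr>carrier = carrier H // subheap_rel H S,
     bracket = (\<lambda>U V W. \<Union>u\<in>U. \<Union>v\<in>V. \<Union>w\<in>W. subheap_rel H S `` {bracket H u v w})\<rparr>"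


section \<open>The free Abelian heap\<close>

text \<open>List positions are counted from 0, so the letters \<open>x\<^sub>i\<close> of a word
  \<open>x\<^sub>1 y\<^sub>1 x\<^sub>2 \<dots> y\<^sub>n x\<^sub>n\<^sub>+\<^sub>1\<close> sit at the even indices and
  the letters \<open>y\<^sub>j\<close> at the odd ones.\<close>

definition sym_word :: "'x list \<Rightarrow> 'x list set" where
  "sym_word w =
    {permute_list p w | p. p permutes {..<length w} \<and> (\<forall>i<length w. even (p i) \<longleftrightarrow> even i)}"

definition reduced :: "'x list set \<Rightarrow> bool" where
  "reduced W \<longleftrightarrow> (\<forall>w\<in>W. distinct_adj w)"

definition prune_step :: "'x list set \<Rightarrow> 'x list set \<Rightarrow> bool" where
  "prune_step W W' \<longleftrightarrow> (\<exists>u x v. u @ [x, x] @ v \<in> W \<and> W' = sym_word (u @ v))"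

definition prune :: "'x list set \<Rightarrow> 'x list set" where
  "prune W = (THE V. prune_step\<^sup>*\<^sup>* W V \<and> reduced V)"

text \<open>The pruned concatenation does not depend on the representatives, because the middle word
  starts at an odd index and the last one at an even index.\<close>

definition free_heap :: "'x set \<Rightarrow> 'x list set ternary" where
  "free_heap X =
    \<lparr>carrier = {sym_word w | w. set w \<subseteq> X \<and> odd (length w) \<and> reduced (sym_word w)},
     bracket = (\<lambda>U V W. prune (sym_word ((SOME u. u \<in> U) @ (SOME v. v \<in> V) @ (SOME w. w \<in> W))))\<rparr>"


section \<open>The direct sum\<close>

definition sum_relators ::
  "('a, 'm) ternary_scheme \<Rightarrow> ('b, 'n) ternary_scheme \<Rightarrow> ('a + 'b) list set \<Rightarrow>
    ('a + 'b) list set set" where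
  "sum_relators A B e =
    (let F = free_heap (carrier A <+> carrier B); \<iota> = (\<lambda>a. sym_word [Inl a]); \<kappa> = (\<lambda>b. sym_word [Inr b])
     in {bracket F (bracket F (\<iota> a) (\<iota> a') (\<iota> a'')) (\<iota> (bracket A a a' a'')) e
          | a a' a''. a \<in> carrier A \<and> a' \<in> carrier A \<and> a'' \<in> carrier A}
      \<union> {bracket F (bracket F (\<kappa> b) (\<kappa> b') (\<kappa> b'')) (\<kappa> (bracket B b b' b'')) e
          | b b' b''. b \<in> carrier B \<and> b' \<in> carrier B \<and> b'' \<in> carrier B})"

definition sum_subheap ::
  "('a, 'm) ternary_scheme \<Rightarrow> ('b, 'n) ternary_scheme \<Rightarrow> ('a + 'b) list set \<Rightarrow>
    ('a + 'b) list set set" where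
  "sum_subheap A B e = subheap (free_heap (carrier A <+> carrier B)) hull sum_relators A B e"

text \<open>The direct sum does not depend on \<open>e\<close>, which is kept as a parameter so that statements can
  be made for every choice of it.\<close>

definition direct_sum ::
  "('a, 'm) ternary_scheme \<Rightarrow> ('b, 'n) ternary_scheme \<Rightarrow> ('a + 'b) list set \<Rightarrow>
    ('a + 'b) list set set ternary" where
  "direct_sum A B e =
    (if carrier A = {} \<and> carrier B = {} then \<lparr>carrier = {}, bracket = (\<lambda>_ _ _. undefined)\<rparr>
     else quotient_heap (free_heap (carrier A <+> carrier B)) (sum_subheap A B e))"

text \<open>The class \<open>\<langle>s\<^sub>1 \<dots> s\<^sub>2\<^sub>n\<^sub>+\<^sub>1\<rangle>\<close>. The word need not be
  reduced, so it is pruned first to give an element of the free Abelian heap.\<close>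

definition word_class ::
  "('a, 'm) ternary_scheme \<Rightarrow> ('b, 'n) ternary_scheme \<Rightarrow> ('a + 'b) list set \<Rightarrow>
    ('a + 'b) list \<Rightarrow> ('a + 'b) list set set" where
  "word_class A B e w =
    subheap_rel (free_heap (carrier A <+> carrier B)) (sum_subheap A B e) `` {prune (sym_word w)}"


section \<open>Special words\<close>

text \<open>\<open>alternating x y n\<close> is \<open>x\<^sub>1 y\<^sub>1 x\<^sub>2 \<dots> x\<^sub>n y\<^sub>n x\<^sub>n\<^sub>+\<^sub>1\<close>,
  of length \<open>2 * n + 1\<close>.\<close>

definition alternating :: "(nat \<Rightarrow> 'x) \<Rightarrow> (nat \<Rightarrow> 'x) \<Rightarrow> nat \<Rightarrow> 'x list" where
  "alternating x y n = concat (map (\<lambda>i. [x i, y i]) [1..<n + 1]) @ [x (n + 1)]"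

definition one_letter_words :: "'a set \<Rightarrow> 'b set \<Rightarrow> ('a + 'b) list set" where
  "one_letter_words A B = {[Inl a] | a. a \<in> A} \<union> {[Inr b] | b. b \<in> B}"

definition three_letter_words :: "'a set \<Rightarrow> 'b set \<Rightarrow> ('a + 'b) list set" where
  "three_letter_words A B =
    {[Inl a, Inr b, Inr b'] | a b b'. a \<in> A \<and> b \<in> B \<and> b' \<in> B \<and> b \<noteq> b'}
    \<union> {[Inl a, Inl a', Inr b] | a a' b. a \<in> A \<and> a' \<in> A \<and> b \<in> B \<and> a \<noteq> a'}"

definition alternating_words :: "'a set \<Rightarrow> 'b set \<Rightarrow> ('a + 'b) list set" where
  "alternating_words A B =
    {alternating (\<lambda>i. Inl (a i)) (\<lambda>i. Inr (b i)) n | a b n.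
       n \<ge> 1 \<and> (\<forall>i\<in>{1..n + 1}. a i \<in> A) \<and> (\<forall>i\<in>{1..n}. b i \<in> B)}
    \<union> {alternating (\<lambda>i. Inr (b i)) (\<lambda>i. Inl (a i)) n | a b n.
       n \<ge> 1 \<and> (\<forall>i\<in>{1..n + 1}. b i \<in> B) \<and> (\<forall>i\<in>{1..n}. a i \<in> A)}"

definition standard_words :: "'a set \<Rightarrow> 'b set \<Rightarrow> 'a \<Rightarrow> 'b \<Rightarrow> ('a + 'b) list set" where
  "standard_words A B eA eB =
    {[Inl a, Inr b, Inr eB] | a b. a \<in> A \<and> b \<in> B}
    \<union> {[Inr b, Inl a, Inl eA] | a b. a \<in> A \<and> b \<in> B}
    \<union> {[Inl a, Inr b] @ alternating (\<lambda>_. Inl eA) (\<lambda>_. Inr eB) m | a b m. a \<in> A \<and> b \<in> B}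
    \<union> {[Inr b, Inl a] @ alternating (\<lambda>_. Inr eB) (\<lambda>_. Inl eA) m | a b m. a \<in> A \<and> b \<in> B}"

end

theory Submission
  imports Defs "HOL-Library.Poly_Mapping"
begin

text \<open>
  Sending a word \<open>x\<^sub>1 y\<^sub>1 x\<^sub>2 \<dots> y\<^sub>n x\<^sub>n\<^sub>+\<^sub>1\<close> to the alternating sum of
  its letters identifies the free Abelian heap on \<open>X\<close> with the elements of coefficient sum one in the
  free Abelian group on \<open>X\<close>: a reduced symmetric word lists the letters of positive and of negative
  coefficient (\<open>prune_sym_word\<close>, \<open>prune_sym_word_eqI\<close>). Passing to the quotient by a sub-heap then
  means working modulo a subgroup of this group (\<open>rel_if_signed_sum\<close>), and for the direct sum this
  subgroup contains \<open>a - a' + a'' - [a, a', a'']\<close> for all \<open>a, a', a''\<close> in \<open>A\<close>, and likewise for \<open>B\<close>.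

  Consider a word whose letters from \<open>A\<close> have total sign \<open>d\<close>; those from \<open>B\<close> have total sign
  \<open>1 - d\<close>. Modulo the subgroup, the part from \<open>A\<close> collapses to \<open>a + (d - 1) e\<^sub>A\<close> for some
  \<open>a\<close> in \<open>A\<close>, where \<open>e\<^sub>A\<close> was chosen in advance, and also to \<open>(d + 1) e\<^sub>A - a'\<close>; the same
  holds for \<open>B\<close> (\<open>signed_sum_split\<close>, \<open>degree_part_neg\<close>). For \<open>d \<ge> 1\<close> the word is therefore
  equivalent to one with alternating sum \<open>a + (d - 1) e\<^sub>A - b + (2 - d) e\<^sub>B\<close>, which is the
  standard word \<open>a b e\<^sub>B\<close> for \<open>d = 1\<close> and \<open>a b e\<^sub>A e\<^sub>B \<dots> e\<^sub>A\<close> for \<open>d \<ge> 2\<close>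
  (\<open>standard_form_pos_degree\<close>). For \<open>d \<le> 0\<close> one exchanges \<open>A\<close> and \<open>B\<close>. This covers every element
  of the direct sum when both heaps are non-empty, and the standard words are of the listed types
  up to a reordering or a cancellation in three-letter words. If one heap is empty, every word collapses to one letter
  (\<open>one_letter_word_exists\<close>).
\<close>

section \<open>Symmetric words, alternating sums and pruning\<close>

text \<open>The multisets of letters at the even and at the odd indices of a word, the latter being
  the letters that count negatively.\<close>

fun pos_letters :: "'x list \<Rightarrow> 'x multiset" and neg_letters :: "'x list \<Rightarrow> 'x multiset" where
  "pos_letters [] = {#}"
| "pos_letters (x # w) = add_mset x (neg_letters w)"
| "neg_letters [] = {#}"
| "neg_letters (x # w) = pos_letters w"

lemma pos_letters_Un_neg_letters: "set_mset (pos_letters w) \<union> set_mset (neg_letters w) = set w"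
  by (induction w) auto

lemma size_letters:
  "size (pos_letters w) = (length w + 1) div 2 \<and> size (neg_letters w) = length w div 2"
  by (induction w) auto

lemma letters_nth:
  "pos_letters w = image_mset ((!) w) (mset_set {i. i < length w \<and> even i}) \<and>
   neg_letters w = image_mset ((!) w) (mset_set {i. i < length w \<and> odd i})"
proof (induction w)
  case (Cons x w)
  have even_eq: "{i. i < length (x # w) \<and> even i} = insert 0 (Suc ` {i. i < length w \<and> odd i})"
    and odd_eq: "{i. i < length (x # w) \<and> odd i} = Suc ` {i. i < length w \<and> even i}"
    by (auto simp: less_Suc_eq_0_disj)
  have suc: "mset_set (Suc ` I) = image_mset Suc (mset_set I)" for I
    by (simp add: image_mset_mset_set)
  show ?case
    unfolding even_eq odd_eq using Cons
    by (auto simp: suc image_mset.compositionality o_def)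
qed simp

text \<open>A symmetric word is determined by the two multisets of letters. The permutation for the
  converse inclusion is composed of one of the even and one of the odd indices.\<close>

lemma sym_word_eq:
  "sym_word w = {v. pos_letters v = pos_letters w \<and> neg_letters v = neg_letters w}"
proof (intro equalityI subsetI)
  fix v
  assume "v \<in> sym_word w"
  then obtain p where v: "v = permute_list p w" and p: "p permutes {..<length w}"
    and parity: "\<forall>i<length w. even (p i) \<longleftrightarrow> even i"
    unfolding sym_word_def by blast
  have p_lt: "p i < length w \<longleftrightarrow> i < length w" for i
    using permutes_in_image[OF p, of i] by simp
  have p_mem: "p i \<in> {i. i < length w \<and> P (even i)} \<longleftrightarrow>
      i \<in> {i. i < length w \<and> P (even i)}" for P i
    using p_lt[of i] parity[rule_format, of i] by (cases "i < length w") simp_all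
  have p_image: "p ` {i. i < length w \<and> P (even i)} = {i. i < length w \<and> P (even i)}"
    (is "p ` ?I = _") for P
  proof (intro equalityI subsetI)
    fix j
    assume j: "j \<in> ?I"
    obtain i where "j = p i"
      using permutes_surj[OF p] by (metis surjD)
    then show "j \<in> p ` ?I"
      using j p_mem[of i P] by blast
  next
    fix j
    assume "j \<in> p ` ?I"
    then show "j \<in> ?I"
      using p_mem[of _ P] by blast
  qed
  have part: "image_mset ((!) v) (mset_set {i. i < length w \<and> P (even i)}) =
      image_mset ((!) w) (mset_set {i. i < length w \<and> P (even i)})"
    (is "image_mset _ (mset_set ?I) = _") for P
  proof -
    have "image_mset ((!) v) (mset_set ?I) = image_mset ((!) w) (image_mset p (mset_set ?I))"
      unfolding image_mset.compositionality
      by (rule image_mset_cong) (auto simp: v permute_list_nth[OF p])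
    also have "image_mset p (mset_set ?I) = mset_set ?I"
      using image_mset_mset_set[of p ?I] permutes_inj_on[OF p] p_image by simp
    finally show ?thesis .
  qed
  show "v \<in> {v. pos_letters v = pos_letters w \<and> neg_letters v = neg_letters w}"
    using part[of "\<lambda>b. b"] part[of Not] letters_nth[of v] letters_nth[of w] by (simp add: v)
next
  fix v
  assume "v \<in> {v. pos_letters v = pos_letters w \<and> neg_letters v = neg_letters w}"
  then have eq: "pos_letters v = pos_letters w" "neg_letters v = neg_letters w"
    by auto
  have "mset v = pos_letters v + neg_letters v" for v :: "'a list"
    by (induction v) auto
  then have len: "length v = length w"
    by (metis eq size_mset)
  let ?E = "{i. i < length w \<and> even i}" and ?O = "{i. i < length w \<and> odd i}"
  obtain p where p: "p permutes ?E" "\<forall>i\<in>?E. v ! i = w ! p i"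
    using image_mset_eq_implies_permutes[of ?E "(!) v" "(!) w"] eq letters_nth[of v] letters_nth[of w]
    by (auto simp: len)
  obtain q where q: "q permutes ?O" "\<forall>i\<in>?O. v ! i = w ! q i"
    using image_mset_eq_implies_permutes[of ?O "(!) v" "(!) w"] eq letters_nth[of v] letters_nth[of w]
    by (auto simp: len)
  have pq: "(p \<circ> q) i = (if even i then p i else q i)" if "i < length w" for i
  proof (cases "even i")
    case True
    then show ?thesis
      using q(1) by (simp add: permutes_not_in)
  next
    case False
    then have "q i \<in> ?O"
      using that permutes_in_image[OF q(1), of i] by simp
    then show ?thesis
      using False p(1) by (simp add: permutes_not_in)
  qed
  have perm: "p \<circ> q permutes {..<length w}"
    by (intro permutes_compose permutes_subset[OF p(1)] permutes_subset[OF q(1)]) auto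
  have parity: "even ((p \<circ> q) i) \<longleftrightarrow> even i" if "i < length w" for i
    using that pq[OF that] permutes_in_image[OF p(1), of i] permutes_in_image[OF q(1), of i] by auto
  have "v = permute_list (p \<circ> q) w"
  proof (rule nth_equalityI)
    fix i
    assume i: "i < length v"
    then show "v ! i = permute_list (p \<circ> q) w ! i"
      unfolding permute_list_nth[OF perm i[unfolded len]]
      using pq[of i] p(2) q(2) by (auto simp: len)
  qed (simp add: len)
  then show "v \<in> sym_word w"
    using perm parity unfolding sym_word_def by blast
qed

text \<open>Splitting off the first letter of a word exchanges the roles of the two multisets, so a word
  with prescribed multisets of letters is built by alternately drawing from one and the other.\<close>

lemma word_with_letters_exists:
  assumes "size P = size N \<or> size P = Suc (size N)"
  shows "\<exists>w. pos_letters w = P \<and> neg_letters w = N"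
  using assms
proof (induction "size P + size N" arbitrary: P N rule: less_induct)
  case less
  show ?case
  proof (cases "P = {#}")
    case True
    then show ?thesis
      using less.prems by (intro exI[of _ "[]"]) auto
  next
    case False
    then obtain x P' where P: "P = add_mset x P'"
      by (metis multiset_nonemptyE insert_DiffM)
    then obtain w where "pos_letters w = N" "neg_letters w = P'"
      using less.hyps[of N P'] less.prems by auto
    then show ?thesis
      using P by (intro exI[of _ "x # w"]) auto
  qed
qed

lemma distinct_adj_if_letters_disjoint:
  "pos_letters w \<inter># neg_letters w = {#} \<Longrightarrow> distinct_adj w"
proof (induction w rule: induct_list012)
  case (3 x y w)
  then show ?case
    by (auto simp: disjunct_not_in distinct_adj_Cons)
qed auto

text \<open>A letter that occurs with both signs can be brought to the front of the word twice, where a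
  pruning step removes it; \<open>v\<close> is what remains.\<close>

lemma cancellable_word:
  assumes "x \<in># pos_letters w" "x \<in># neg_letters w"
  obtains v where "[x, x] @ v \<in> sym_word w" "length v < length w"
proof -
  obtain P N where PN: "pos_letters w = add_mset x P" "neg_letters w = add_mset x N"
    using assms by (metis insert_DiffM)
  then have "size P = size N \<or> size P = Suc (size N)"
    using size_letters[of w] by auto
  then obtain v where v: "pos_letters v = P" "neg_letters v = N"
    using word_with_letters_exists by blast
  then have "size (pos_letters w) = Suc (size (pos_letters v))"
    by (simp add: PN)
  then have "length v < length w"
    using size_letters[of w] size_letters[of v] by linarith
  then show thesis
    using that[of v] v PN by (simp add: sym_word_eq)
qed

lemma reduced_sym_word_iff:
  "reduced (sym_word w) \<longleftrightarrow> pos_letters w \<inter># neg_letters w = {#}"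
proof
  assume red: "reduced (sym_word w)"
  show "pos_letters w \<inter># neg_letters w = {#}"
  proof (rule ccontr)
    assume "pos_letters w \<inter># neg_letters w \<noteq> {#}"
    then obtain x where "x \<in># pos_letters w" "x \<in># neg_letters w"
      by (auto simp: disjunct_not_in)
    then obtain v where "[x, x] @ v \<in> sym_word w"
      by (rule cancellable_word)
    then show False
      using red unfolding reduced_def by fastforce
  qed
next
  assume "pos_letters w \<inter># neg_letters w = {#}"
  then show "reduced (sym_word w)"
    unfolding reduced_def by (auto simp: sym_word_eq intro!: distinct_adj_if_letters_disjoint)
qed

text \<open>The alternating sum \<open>x\<^sub>1 - y\<^sub>1 + x\<^sub>2 - \<dots>\<close> of the letters of a word, in the
  free Abelian group on the letters. It is invariant under parity-preserving permutations and
  pruning.\<close>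

definition signed_sum :: "'x list \<Rightarrow> 'x \<Rightarrow>\<^sub>0 int" where
  "signed_sum w = foldr (\<lambda>x k. frag_of x - k) w 0"

lemma signed_sum_simps [simp]:
  "signed_sum [] = 0"
  "signed_sum (x # w) = frag_of x - signed_sum w"
  by (simp_all add: signed_sum_def)

lemma signed_sum_append:
  "signed_sum (u @ v) = signed_sum u + (if even (length u) then signed_sum v else - signed_sum v)"
  by (induction u) (auto simp: algebra_simps)

lemma lookup_signed_sum:
  "Poly_Mapping.lookup (signed_sum w) x =
    int (count (pos_letters w) x) - int (count (neg_letters w) x)"
  by (induction w) (auto simp: lookup_minus)

lemma prune_step_sym_word:
  assumes "prune_step (sym_word w) V"
  shows "\<exists>v. V = sym_word v \<and> signed_sum v = signed_sum w"
proof -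
  obtain u x v where uv: "u @ [x, x] @ v \<in> sym_word w" "V = sym_word (u @ v)"
    using assms unfolding prune_step_def by blast
  have "signed_sum (u @ [x, x] @ v) = signed_sum w"
    using uv(1) by (intro poly_mapping_eqI) (simp add: lookup_signed_sum sym_word_eq del: append_Cons)
  moreover have "signed_sum (u @ [x, x] @ v) = signed_sum (u @ v)"
    by (simp add: signed_sum_append)
  ultimately show ?thesis
    using uv(2) by auto
qed

lemma prune_steps_sym_word:
  "prune_step\<^sup>*\<^sup>* (sym_word w) V \<Longrightarrow> \<exists>v. V = sym_word v \<and> signed_sum v = signed_sum w"
proof (induction rule: rtranclp_induct)
  case (step U V)
  then show ?case
    by (metis prune_step_sym_word)
qed auto

lemma prune_steps_to_reduced:
  "\<exists>v. prune_step\<^sup>*\<^sup>* (sym_word w) (sym_word v) \<and> reduced (sym_word v)"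
proof (induction "length w" arbitrary: w rule: less_induct)
  case less
  show ?case
  proof (cases "reduced (sym_word w)")
    case False
    then obtain x where "x \<in># pos_letters w" "x \<in># neg_letters w"
      by (auto simp: reduced_sym_word_iff disjunct_not_in)
    then obtain v where v: "[x, x] @ v \<in> sym_word w" "length v < length w"
      by (rule cancellable_word)
    have "prune_step (sym_word w) (sym_word v)"
      unfolding prune_step_def using v(1) by (intro exI[of _ "[]"] exI[of _ x] exI[of _ v]) simp
    then show ?thesis
      using less[OF v(2)] by (meson converse_rtranclp_into_rtranclp)
  qed blast
qed

text \<open>In a reduced symmetric word no letter occurs with both signs, so the alternating sum
  determines the multisets of letters: its positive and its negative part.\<close>

lemma reduced_letters:
  assumes "reduced (sym_word v)"
  shows "count (pos_letters v) x = nat (Poly_Mapping.lookup (signed_sum v) x)"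
    "count (neg_letters v) x = nat (- Poly_Mapping.lookup (signed_sum v) x)"
proof -
  have "count (pos_letters v) x = 0 \<or> count (neg_letters v) x = 0"
    using assms by (metis reduced_sym_word_iff disjunct_not_in count_eq_zero_iff)
  then show "count (pos_letters v) x = nat (Poly_Mapping.lookup (signed_sum v) x)"
    "count (neg_letters v) x = nat (- Poly_Mapping.lookup (signed_sum v) x)"
    by (auto simp: lookup_signed_sum)
qed

lemma reduced_sym_word_unique:
  assumes "reduced (sym_word u)" "reduced (sym_word v)" "signed_sum u = signed_sum v"
  shows "sym_word u = sym_word v"
proof -
  have "pos_letters u = pos_letters v" "neg_letters u = neg_letters v"
    using assms by (auto intro!: multiset_eqI simp: reduced_letters)
  then show ?thesis
    by (simp add: sym_word_eq)
qed

text \<open>Pruning terminates, and by the uniqueness of the reduced symmetric word with a given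
  alternating sum its result is unique; hence the definite description in \<^const>\<open>prune\<close> is
  meaningful.\<close>

lemma prune_sym_word:
  obtains v where "prune (sym_word w) = sym_word v" "reduced (sym_word v)"
    "signed_sum v = signed_sum w"
proof -
  obtain v where v: "prune_step\<^sup>*\<^sup>* (sym_word w) (sym_word v)" "reduced (sym_word v)"
    using prune_steps_to_reduced by blast
  obtain v' where v': "sym_word v = sym_word v'" "signed_sum v' = signed_sum w"
    using prune_steps_sym_word[OF v(1)] by blast
  have "V = sym_word v'" if V: "prune_step\<^sup>*\<^sup>* (sym_word w) V" "reduced V" for V
    using prune_steps_sym_word[OF V(1)] V(2) v' v(2) reduced_sym_word_unique by metis
  then have "prune (sym_word w) = sym_word v'"
    unfolding prune_def using v[unfolded v'(1)] by (intro the_equality conjI) blast+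
  then show thesis
    using that[of v'] v(2)[unfolded v'(1)] v'(2) by blast
qed

lemma prune_sym_word_eqI:
  assumes "signed_sum u = signed_sum v"
  shows "prune (sym_word u) = prune (sym_word v)"
  by (metis assms prune_sym_word reduced_sym_word_unique)

lemma prune_sym_word_reduced:
  assumes "reduced (sym_word w)"
  shows "prune (sym_word w) = sym_word w"
  by (metis assms prune_sym_word reduced_sym_word_unique)

text \<open>Any representative of the reduced form of \<open>w\<close> uses only letters of \<open>w\<close> and has a length of
  the same parity.\<close>

lemma mem_reduced_sym_word:
  assumes "v \<in> sym_word u" "reduced (sym_word u)" "signed_sum u = signed_sum w"
  shows "signed_sum v = signed_sum w" "set v \<subseteq> set w" "even (length v) \<longleftrightarrow> even (length w)"
proof -
  have letters: "pos_letters v = pos_letters u" "neg_letters v = neg_letters u"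
    using assms(1) by (auto simp: sym_word_eq)
  then show sum: "signed_sum v = signed_sum w"
    using assms(3) by (intro poly_mapping_eqI) (metis lookup_signed_sum)
  have red: "reduced (sym_word v)"
    using assms(2) letters by (simp add: reduced_sym_word_iff)
  have le: "count (pos_letters v) x \<le> count (pos_letters w) x"
    "count (neg_letters v) x \<le> count (neg_letters w) x" for x
    unfolding reduced_letters[OF red] sum by (simp_all add: lookup_signed_sum)
  then have "pos_letters v \<subseteq># pos_letters w" "neg_letters v \<subseteq># neg_letters w"
    by (auto simp: subseteq_mset_def)
  then have "set_mset (pos_letters v) \<union> set_mset (neg_letters v) \<subseteq>
      set_mset (pos_letters w) \<union> set_mset (neg_letters w)"
    by (meson set_mset_mono sup.mono)
  then show "set v \<subseteq> set w"
    unfolding pos_letters_Un_neg_letters .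
  \<comment> \<open>Lengths are compared through the sizes of the multisets of letters.\<close>
  have "pos_letters v + neg_letters w = pos_letters w + neg_letters v"
  proof (rule multiset_eqI)
    fix x
    show "count (pos_letters v + neg_letters w) x = count (pos_letters w + neg_letters v) x"
      using lookup_signed_sum[of v x] lookup_signed_sum[of w x] unfolding sum count_union by linarith
  qed
  then have "size (pos_letters v) + size (neg_letters w) = size (pos_letters w) + size (neg_letters v)"
    by (metis size_union)
  then show "even (length v) \<longleftrightarrow> even (length w)"
    using size_letters[of v] size_letters[of w] by presburger
qed


section \<open>The free Abelian heap in terms of words\<close>

text \<open>The words over \<open>X\<close> that represent elements of the free Abelian heap; they need not be
  reduced.\<close>

definition odd_words :: "'x set \<Rightarrow> 'x list set" where
  "odd_words X = {w. set w \<subseteq> X \<and> odd (length w)}"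

lemma odd_words_append3:
  "\<lbrakk>u \<in> odd_words X; v \<in> odd_words X; w \<in> odd_words X\<rbrakk> \<Longrightarrow> u @ v @ w \<in> odd_words X"
  by (auto simp: odd_words_def)

lemma signed_sum_append3:
  assumes "u \<in> odd_words X" "v \<in> odd_words X"
  shows "signed_sum (u @ v @ w) = signed_sum u - signed_sum v + signed_sum w"
  using assms by (simp add: odd_words_def signed_sum_append)

lemma carrier_free_heap: "carrier (free_heap X) = (\<lambda>w. prune (sym_word w)) ` odd_words X"
proof (intro equalityI subsetI)
  fix V
  assume "V \<in> carrier (free_heap X)"
  then obtain w where "V = sym_word w" "set w \<subseteq> X" "odd (length w)" "reduced (sym_word w)"
    by (auto simp: free_heap_def)
  then show "V \<in> (\<lambda>w. prune (sym_word w)) ` odd_words X"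
    by (auto simp: odd_words_def prune_sym_word_reduced intro!: image_eqI[of _ _ w])
next
  fix V
  assume "V \<in> (\<lambda>w. prune (sym_word w)) ` odd_words X"
  then obtain w where w: "V = prune (sym_word w)" "w \<in> odd_words X"
    by blast
  obtain v where v: "prune (sym_word w) = sym_word v" "reduced (sym_word v)" "signed_sum v = signed_sum w"
    by (rule prune_sym_word)
  have "v \<in> odd_words X"
    using mem_reduced_sym_word[of v v w] v w(2) by (auto simp: sym_word_eq odd_words_def)
  then show "V \<in> carrier (free_heap X)"
    using v w(1) by (auto simp: free_heap_def odd_words_def)
qed

lemma some_mem_prune:
  assumes "w \<in> odd_words X"
  defines "v \<equiv> SOME v. v \<in> prune (sym_word w)"
  shows "v \<in> odd_words X" "signed_sum v = signed_sum w"
proof -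
  obtain u where u: "prune (sym_word w) = sym_word u" "reduced (sym_word u)" "signed_sum u = signed_sum w"
    by (rule prune_sym_word)
  have "u \<in> sym_word u"
    by (simp add: sym_word_eq)
  then have "v \<in> sym_word u"
    unfolding v_def u(1) by (rule someI)
  then show "v \<in> odd_words X" "signed_sum v = signed_sum w"
    using mem_reduced_sym_word[of v u w] u assms(1) by (auto simp: odd_words_def)
qed

lemma bracket_free_heap:
  assumes "u \<in> odd_words X" "v \<in> odd_words X" "w \<in> odd_words X"
  shows "bracket (free_heap X) (prune (sym_word u)) (prune (sym_word v)) (prune (sym_word w)) =
    prune (sym_word (u @ v @ w))"
proof -
  have "signed_sum ((SOME x. x \<in> prune (sym_word u)) @ (SOME x. x \<in> prune (sym_word v)) @
      (SOME x. x \<in> prune (sym_word w))) = signed_sum (u @ v @ w)"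
    using assms some_mem_prune[of _ X] by (simp add: signed_sum_append3[of _ X])
  from prune_sym_word_eqI[OF this] show ?thesis
    unfolding free_heap_def by simp
qed

lemma heap_free_heap: "heap (free_heap X)"
proof
  fix a b c d e
  assume "a \<in> carrier (free_heap X)" "b \<in> carrier (free_heap X)" "c \<in> carrier (free_heap X)"
    "d \<in> carrier (free_heap X)" "e \<in> carrier (free_heap X)"
  then show "bracket (free_heap X) (bracket (free_heap X) a b c) d e =
      bracket (free_heap X) a b (bracket (free_heap X) c d e)"
    by (auto simp: carrier_free_heap bracket_free_heap odd_words_append3)
next
  fix a b
  assume "a \<in> carrier (free_heap X)" "b \<in> carrier (free_heap X)"
  then obtain u v where "u \<in> odd_words X" "v \<in> odd_words X"
      "a = prune (sym_word u)" "b = prune (sym_word v)"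
    by (auto simp: carrier_free_heap)
  moreover have "prune (sym_word (u @ v @ v)) = prune (sym_word u)"
    "prune (sym_word (v @ v @ u)) = prune (sym_word u)"
    using calculation by (intro prune_sym_word_eqI; simp add: signed_sum_append3[of _ X])+
  ultimately show "bracket (free_heap X) a b b = a" "bracket (free_heap X) b b a = a"
    by (simp_all add: bracket_free_heap)
qed (auto simp: carrier_free_heap bracket_free_heap odd_words_append3)


section \<open>Quotients of free Abelian heaps\<close>

lemma (in heap) equiv_subheap_rel:
  assumes S: "subheap H S" "S \<noteq> {}"
  shows "equiv (carrier H) (subheap_rel H S)"
proof (rule equivI)
  have in_H: "x \<in> carrier H" if "x \<in> S" for x
    using S that by (auto simp: subheap_def)
  show "subheap_rel H S \<subseteq> carrier H \<times> carrier H"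
    by (auto simp: subheap_rel_def)
  show "refl_on (carrier H) (subheap_rel H S)"
    using S by (auto simp: refl_on_def subheap_rel_def bracket_left_cancel in_H)
  show "sym (subheap_rel H S)"
  proof (rule symI)
    fix a b
    assume "(a, b) \<in> subheap_rel H S"
    then obtain s where s: "a \<in> carrier H" "b \<in> carrier H" "s \<in> S" "bracket H a b s \<in> S"
      by (auto simp: subheap_rel_def)
    then have "bracket H b a (bracket H a b s) = s"
      by (simp add: in_H bracket_assoc[symmetric] bracket_right_cancel bracket_left_cancel)
    then show "(b, a) \<in> subheap_rel H S"
      using s by (auto simp: subheap_rel_def intro!: bexI[of _ "bracket H a b s"])
  qed
  show "trans (subheap_rel H S)"
  proof (rule transI)
    fix a b c
    assume "(a, b) \<in> subheap_rel H S" "(b, c) \<in> subheap_rel H S"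
    then obtain s t where s: "a \<in> carrier H" "b \<in> carrier H" "c \<in> carrier H" "s \<in> S" "t \<in> S"
        "bracket H a b s \<in> S" "bracket H b c t \<in> S"
      by (auto simp: subheap_rel_def)
    have "bracket H a c t = bracket H a b (bracket H b c t)"
      using s by (simp add: in_H bracket_assoc[symmetric] bracket_right_cancel)
    also have "\<dots> = bracket H a b (bracket H s s (bracket H b c t))"
      using s by (simp add: in_H bracket_left_cancel)
    also have "\<dots> = bracket H (bracket H a b s) s (bracket H b c t)"
      using s by (simp only: in_H bracket_assoc)
    also have "\<dots> \<in> S"
      using s S by (auto simp: subheap_def)
    finally show "(a, c) \<in> subheap_rel H S"
      using s by (auto simp: subheap_rel_def)
  qed
qed

lemma subheap_hull:
  assumes "heap H" "R \<subseteq> carrier H"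
  shows "subheap H (subheap H hull R)"
proof -
  have "subheap H (carrier H)"
    using assms(1) by (simp add: subheap_def heap.bracket_closed)
  then show ?thesis
    using assms(2) unfolding hull_def subheap_def by blast
qed

text \<open>The quotient of the free Abelian heap on \<open>X\<close> by a non-empty sub-heap \<open>S\<close>. The set
  \<open>relations\<close> consists of the differences of the alternating sums of equivalent words. It is a
  subgroup of the free Abelian group, and two words in \<open>odd_words X\<close> are equivalent if and only if the
  difference of their alternating sums lies in it.\<close>

locale subheap_quotient =
  fixes X :: "'x set" and S :: "'x list set set"
  assumes subheap: "subheap (free_heap X) S" and nonempty: "S \<noteq> {}"
begin

abbreviation "rel \<equiv> subheap_rel (free_heap X) S"

definition relations :: "('x \<Rightarrow>\<^sub>0 int) set" where
  "relations = {signed_sum u - signed_sum v | u v.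
     u \<in> odd_words X \<and> v \<in> odd_words X \<and> (prune (sym_word u), prune (sym_word v)) \<in> rel}"

lemma rel_equiv: "equiv (carrier (free_heap X)) rel"
  using heap.equiv_subheap_rel[OF heap_free_heap subheap nonempty] .

lemma S_word:
  assumes "s \<in> S"
  obtains w where "w \<in> odd_words X" "s = prune (sym_word w)"
  using assms subheap unfolding subheap_def carrier_free_heap by blast

lemma rel_if_signed_sum:
  assumes "u \<in> odd_words X" "v \<in> odd_words X" "signed_sum u - signed_sum v \<in> relations"
  shows "(prune (sym_word u), prune (sym_word v)) \<in> rel"
proof -
  obtain u' v' where uv': "signed_sum u - signed_sum v = signed_sum u' - signed_sum v'"
      "u' \<in> odd_words X" "v' \<in> odd_words X" "(prune (sym_word u'), prune (sym_word v')) \<in> rel"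
    using assms(3) unfolding relations_def by blast
  then obtain s where s: "s \<in> S"
      "bracket (free_heap X) (prune (sym_word u')) (prune (sym_word v')) s \<in> S"
    by (auto simp: subheap_rel_def)
  obtain w where w: "w \<in> odd_words X" "s = prune (sym_word w)"
    using S_word[OF s(1)] .
  \<comment> \<open>Both brackets have the alternating sum of \<open>w\<close> plus the same difference.\<close>
  have "prune (sym_word (u @ v @ w)) = prune (sym_word (u' @ v' @ w))"
    by (intro prune_sym_word_eqI) (use assms uv' w in \<open>simp add: signed_sum_append3[of _ X]\<close>)
  then have "bracket (free_heap X) (prune (sym_word u)) (prune (sym_word v)) s \<in> S"
    using s w uv' assms by (simp add: bracket_free_heap)
  then show ?thesis
    using s(1) assms by (auto simp: subheap_rel_def carrier_free_heap)
qed

lemma class_eqI: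
  assumes "u \<in> odd_words X" "v \<in> odd_words X" "signed_sum u - signed_sum v \<in> relations"
  shows "rel `` {prune (sym_word u)} = rel `` {prune (sym_word v)}"
  using equiv_class_eq[OF rel_equiv rel_if_signed_sum[OF assms]] .

lemma zero_relation: "0 \<in> relations"
proof -
  obtain w where "w \<in> odd_words X" "prune (sym_word w) \<in> S"
    using nonempty S_word by (metis ex_in_conv)
  then have "(prune (sym_word w), prune (sym_word w)) \<in> rel"
    using rel_equiv by (auto simp: carrier_free_heap equiv_def refl_on_def)
  then show ?thesis
    using \<open>w \<in> odd_words X\<close> unfolding relations_def by force
qed

lemma uminus_relation:
  assumes "k \<in> relations"
  shows "- k \<in> relations"
proof -
  obtain u v where uv: "k = signed_sum u - signed_sum v" "u \<in> odd_words X" "v \<in> odd_words X"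
      "(prune (sym_word u), prune (sym_word v)) \<in> rel"
    using assms unfolding relations_def by blast
  have "(prune (sym_word v), prune (sym_word u)) \<in> rel"
    using rel_equiv uv(4) by (meson equivE symD)
  moreover have "- k = signed_sum v - signed_sum u"
    using uv(1) by simp
  ultimately show ?thesis
    using uv unfolding relations_def by blast
qed

lemma add_relation:
  assumes "k \<in> relations" "l \<in> relations"
  shows "k + l \<in> relations"
proof -
  obtain u v where uv: "l = signed_sum u - signed_sum v" "u \<in> odd_words X" "v \<in> odd_words X"
      "(prune (sym_word u), prune (sym_word v)) \<in> rel"
    using assms(2) unfolding relations_def by blast
  obtain u' v' where uv': "k = signed_sum u' - signed_sum v'" "u' \<in> odd_words X" "v' \<in> odd_words X"
    using assms(1) unfolding relations_def by blast
  have odd: "u' @ v' @ u \<in> odd_words X"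
    using uv uv' by (intro odd_words_append3)
  have sum: "signed_sum (u' @ v' @ u) = k + signed_sum u"
    using uv uv' by (simp add: signed_sum_append3[of _ X])
  have "(prune (sym_word (u' @ v' @ u)), prune (sym_word u)) \<in> rel"
    using odd uv(2) assms(1) sum by (intro rel_if_signed_sum) auto
  then have "(prune (sym_word (u' @ v' @ u)), prune (sym_word v)) \<in> rel"
    using uv(4) rel_equiv by (meson equivE transD)
  moreover have "k + l = signed_sum (u' @ v' @ u) - signed_sum v"
    using sum uv(1) by simp
  ultimately show ?thesis
    using odd uv(3) unfolding relations_def by blast
qed

text \<open>This is how the generators of \<open>S\<close> enter: \<open>u\<close> and \<open>v\<close> are equivalent if their bracket with
  an element of \<open>S\<close> lies in \<open>S\<close>.\<close>

lemma signed_sum_relation: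
  assumes "u \<in> odd_words X" "v \<in> odd_words X" "w \<in> odd_words X"
    "prune (sym_word w) \<in> S" "prune (sym_word (u @ v @ w)) \<in> S"
  shows "signed_sum u - signed_sum v \<in> relations"
proof -
  have "(prune (sym_word u), prune (sym_word v)) \<in> rel"
    using assms
    by (auto simp: subheap_rel_def carrier_free_heap bracket_free_heap
        intro!: bexI[of _ "prune (sym_word w)"])
  then show ?thesis
    using assms(1,2) unfolding relations_def by blast
qed

end


section \<open>Collapsing combinations of heap elements\<close>

text \<open>A map \<open>f\<close> from a heap \<open>H\<close> to the letters, and a subgroup \<open>K\<close> of the free Abelian group
  on the letters modulo which \<open>f\<close> turns the brackets of \<open>H\<close> into alternating sums.\<close>

locale heap_presentation = heap H for H :: "('a, 'm) ternary_scheme" +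
  fixes f :: "'a \<Rightarrow> 'x" and K :: "('x \<Rightarrow>\<^sub>0 int) set"
  assumes zero: "0 \<in> K"
    and uminus: "k \<in> K \<Longrightarrow> - k \<in> K"
    and add: "\<lbrakk>k \<in> K; l \<in> K\<rbrakk> \<Longrightarrow> k + l \<in> K"
    and relator: "\<lbrakk>a \<in> carrier H; b \<in> carrier H; c \<in> carrier H\<rbrakk> \<Longrightarrow>
      frag_of (f a) - frag_of (f b) + frag_of (f c) - frag_of (f (bracket H a b c)) \<in> K"
begin

lemma diff: "\<lbrakk>k \<in> K; l \<in> K\<rbrakk> \<Longrightarrow> k - l \<in> K"
  using add[of k "- l"] uminus by simp

text \<open>Modulo \<open>K\<close>, the integral combinations of degree \<open>d\<close> of letters from \<open>H\<close>: once an element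
  \<open>e\<close> is chosen, each of them collapses to a single letter \<open>a\<close> plus \<open>d - 1\<close> times \<open>e\<close>. The
  degree may be negative.\<close>

definition degree_part :: "'a \<Rightarrow> int \<Rightarrow> ('x \<Rightarrow>\<^sub>0 int) set" where
  "degree_part e d =
    {k. \<exists>a \<in> carrier H. k - (frag_of (f a) + frag_cmul (d - 1) (frag_of (f e))) \<in> K}"

lemma zero_degree_part:
  assumes "e \<in> carrier H"
  shows "0 \<in> degree_part e 0"
  unfolding degree_part_def using assms zero by (auto intro!: bexI[of _ e])

lemma degree_partI:
  assumes "a \<in> carrier H" "k - (frag_of (f a) + frag_cmul (d - 1) (frag_of (f e))) \<in> K"
  shows "k \<in> degree_part e d"
  using assms unfolding degree_part_def by blast

text \<open>The same combinations can be written with a negative letter, since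
  \<open>a = 2 e - [e, a, e]\<close> modulo \<open>K\<close>.\<close>

lemma degree_part_neg:
  assumes "e \<in> carrier H" "k \<in> degree_part e d"
  shows "\<exists>a \<in> carrier H. k - (frag_cmul (d + 1) (frag_of (f e)) - frag_of (f a)) \<in> K"
proof -
  obtain a where a: "a \<in> carrier H" "k - (frag_of (f a) + frag_cmul (d - 1) (frag_of (f e))) \<in> K"
    using assms(2) unfolding degree_part_def by blast
  let ?a = "bracket H e a e"
  have "frag_of (f e) - frag_of (f a) + frag_of (f e) - frag_of (f ?a) \<in> K"
    using assms(1) a(1) by (intro relator)
  from diff[OF a(2) this]
  have "k - (frag_cmul (d + 1) (frag_of (f e)) - frag_of (f ?a)) \<in> K"
    by (rule back_subst[of "\<lambda>k. k \<in> K"])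
      (intro poly_mapping_eqI, simp add: lookup_add lookup_minus algebra_simps)
  then show ?thesis
    using a(1) assms(1) bracket_closed by blast
qed

lemma uminus_degree_part:
  assumes "e \<in> carrier H" "k \<in> degree_part e d"
  shows "- k \<in> degree_part e (- d)"
proof -
  obtain a where a: "a \<in> carrier H" "k - (frag_cmul (d + 1) (frag_of (f e)) - frag_of (f a)) \<in> K"
    using degree_part_neg[OF assms] by blast
  from uminus[OF a(2)] have "- k - (frag_of (f a) + frag_cmul (- d - 1) (frag_of (f e))) \<in> K"
    by (rule back_subst[of "\<lambda>k. k \<in> K"])
      (intro poly_mapping_eqI, simp add: lookup_add lookup_minus algebra_simps)
  then show ?thesis
    using a(1) by (intro degree_partI)
qed

lemma letter_diff_degree_part:
  assumes "e \<in> carrier H" "c \<in> carrier H" "k \<in> degree_part e d"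
  shows "frag_of (f c) - k \<in> degree_part e (1 - d)"
proof -
  obtain a where a: "a \<in> carrier H" "k - (frag_of (f a) + frag_cmul (d - 1) (frag_of (f e))) \<in> K"
    using assms(3) unfolding degree_part_def by blast
  \<comment> \<open>Modulo \<open>K\<close>, the letters \<open>c - a\<close> become \<open>[c, a, e] - e\<close>.\<close>
  let ?a = "bracket H c a e"
  have "frag_of (f c) - frag_of (f a) + frag_of (f e) - frag_of (f ?a) \<in> K"
    using assms(1,2) a(1) by (intro relator)
  from diff[OF this a(2)]
  have "frag_of (f c) - k - (frag_of (f ?a) + frag_cmul (1 - d - 1) (frag_of (f e))) \<in> K"
    by (rule back_subst[of "\<lambda>k. k \<in> K"])
      (intro poly_mapping_eqI, simp add: lookup_add lookup_minus algebra_simps)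
  then show ?thesis
    using assms(1,2) a(1) bracket_closed by (intro degree_partI)
qed

lemma signed_sum_degree_part:
  assumes "e \<in> carrier H" "set w \<subseteq> f ` carrier H"
  shows "signed_sum w \<in> degree_part e (if even (length w) then 0 else 1)"
  using assms(2)
proof (induction w)
  case (Cons x w)
  then show ?case
    using letter_diff_degree_part[OF assms(1), of _ "signed_sum w" "if even (length w) then 0 else 1"]
    by auto
qed (use zero_degree_part[OF assms(1)] in simp)

text \<open>In degree one the chosen element does not appear any more.\<close>

lemma odd_word_degree_part:
  assumes "set w \<subseteq> f ` carrier H" "odd (length w)"
  obtains a where "a \<in> carrier H" "signed_sum w - frag_of (f a) \<in> K"
proof -
  obtain c where "c \<in> carrier H"
    using assms by (cases w) auto
  then show thesis
    using signed_sum_degree_part[OF _ assms(1), of c] assms(2) that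
    by (auto simp: degree_part_def)
qed

end

lemma signed_sum_split:
  assumes "heap_presentation A f K" "heap_presentation B g K"
    and "eA \<in> carrier A" "eB \<in> carrier B"
    and "set w \<subseteq> f ` carrier A \<union> g ` carrier B"
  obtains k l d where "signed_sum w = k + l"
    "k \<in> heap_presentation.degree_part A f K eA d"
    "l \<in> heap_presentation.degree_part B g K eB ((if even (length w) then 0 else 1) - d)"
proof -
  interpret A: heap_presentation A f K by fact
  interpret B: heap_presentation B g K by fact
  have "\<exists>k l d. signed_sum w = k + l \<and> k \<in> A.degree_part eA d \<and>
      l \<in> B.degree_part eB ((if even (length w) then 0 else 1) - d)"
    using assms(5)
  proof (induction w)
    case Nil
    then show ?case
      using A.zero_degree_part[OF assms(3)] B.zero_degree_part[OF assms(4)]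
      by (intro exI[of _ 0]) simp
  next
    case (Cons x w)
    then obtain k l d where kl: "signed_sum w = k + l" "k \<in> A.degree_part eA d"
        "l \<in> B.degree_part eB ((if even (length w) then 0 else 1) - d)"
      by auto
    from Cons.prems consider a where "x = f a" "a \<in> carrier A" | b where "x = g b" "b \<in> carrier B"
      by auto
    then show ?case
    proof cases
      case 1
      have "- l \<in> B.degree_part eB ((if even (length (x # w)) then 0 else 1) - (1 - d))"
        using B.uminus_degree_part[OF assms(4) kl(3)] by (auto split: if_splits)
      then show ?thesis
        using A.letter_diff_degree_part[OF assms(3) 1(2) kl(2)] kl(1) 1(1)
        by (intro exI[of _ "frag_of x - k"] exI[of _ "- l"] exI[of _ "1 - d"]) auto
    next
      case 2
      have "frag_of x - l \<in> B.degree_part eB ((if even (length (x # w)) then 0 else 1) - (- d))"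
        using B.letter_diff_degree_part[OF assms(4) 2(2) kl(3)] 2(1) by (auto split: if_splits)
      then show ?thesis
        using A.uminus_degree_part[OF assms(3) kl(2)] kl(1)
        by (intro exI[of _ "- k"] exI[of _ "frag_of x - l"] exI[of _ "- d"]) auto
    qed
  qed
  then show thesis
    using that by blast
qed


section \<open>Alternating words\<close>

lemma alternating_Suc:
  "alternating x y (Suc n) = [x 1, y 1] @ alternating (\<lambda>i. x (Suc i)) (\<lambda>i. y (Suc i)) n"
proof -
  have "[1..<Suc n + 1] = 1 # map Suc [1..<n + 1]"
    by (subst upt_conv_Cons) (simp_all add: map_Suc_upt)
  then show ?thesis
    by (simp add: alternating_def o_def)
qed

lemma alternating_cong:
  assumes "\<And>i. i \<ge> 1 \<Longrightarrow> x i = x' i" "\<And>i. i \<ge> 1 \<Longrightarrow> y i = y' i"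
  shows "alternating x y n = alternating x' y' n"
proof -
  have "map (\<lambda>i. [x i, y i]) [1..<n + 1] = map (\<lambda>i. [x' i, y' i]) [1..<n + 1]"
    using assms by (intro map_cong) auto
  then show ?thesis
    using assms(1)[of "n + 1"] by (simp only: alternating_def)
qed

lemma Cons_Cons_alternating:
  "[a, b] @ alternating (\<lambda>_. x) (\<lambda>_. y) n =
    alternating (\<lambda>i. if i = 1 then a else x) (\<lambda>i. if i = 1 then b else y) (Suc n)"
  unfolding alternating_Suc by (auto intro!: alternating_cong)

lemma length_alternating: "length (alternating x y n) = 2 * n + 1"
  by (induction n arbitrary: x y) (simp add: alternating_def, simp add: alternating_Suc)

lemma set_alternating:
  "set (alternating x y n) = x ` {1..n + 1} \<union> y ` {1..n}"
proof -
  have "{1..n + 1} = insert (n + 1) {1..n}" "set [1..<n + 1] = {1..n}"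
    by auto
  then show ?thesis
    unfolding alternating_def set_append set_concat set_map by auto
qed

lemma signed_sum_alternating_const:
  "signed_sum (alternating (\<lambda>_. x) (\<lambda>_. y) m) =
    frag_cmul (int m + 1) (frag_of x) - frag_cmul (int m) (frag_of y)"
proof (induction m)
  case 0
  then show ?case by (simp add: alternating_def)
next
  case (Suc m)
  then show ?case
    by (simp add: alternating_Suc)
      (intro poly_mapping_eqI, simp add: lookup_add lookup_minus algebra_simps)
qed

text \<open>Collapsing the letters of degree \<open>d \<ge> 1\<close> from one heap to \<open>a + (d - 1) e\<^sub>A\<close> and those of
  degree \<open>1 - d\<close> from the other one to \<open>(2 - d) e\<^sub>B - b\<close> gives the alternating sum of
  \<open>a b e\<^sub>B\<close> if \<open>d = 1\<close>, and of \<open>a b\<close> followed by an alternating word in \<open>e\<^sub>A\<close>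
  and \<open>e\<^sub>B\<close> otherwise. The remaining case \<open>d \<le> 0\<close> is the same with the two heaps exchanged.\<close>

lemma standard_form_pos_degree:
  assumes "heap_presentation A f K" "heap_presentation B g K"
    and e: "eA \<in> carrier A" "eB \<in> carrier B"
    and kl: "k \<in> heap_presentation.degree_part A f K eA d"
      "l \<in> heap_presentation.degree_part B g K eB (1 - d)"
    and "d \<ge> 1"
  obtains a b v where "a \<in> carrier A" "b \<in> carrier B"
    "v = [f a, g b, g eB] \<or>
      (\<exists>m. v = [f a, g b] @ alternating (\<lambda>_. f eA) (\<lambda>_. g eB) m)"
    "k + l - signed_sum v \<in> K"
proof -
  interpret A: heap_presentation A f K by fact
  interpret B: heap_presentation B g K by fact
  obtain a where a: "a \<in> carrier A" "k - (frag_of (f a) + frag_cmul (d - 1) (frag_of (f eA))) \<in> K"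
    using kl(1) unfolding A.degree_part_def by blast
  obtain b where b: "b \<in> carrier B" "l - (frag_cmul (1 - d + 1) (frag_of (g eB)) - frag_of (g b)) \<in> K"
    using B.degree_part_neg[OF e(2) kl(2)] by blast
  note sum = A.add[OF a(2) b(2)]
  show thesis
  proof (cases "d = 1")
    case True
    have "k + l - signed_sum [f a, g b, g eB] \<in> K"
      using sum by (rule back_subst[of "\<lambda>k. k \<in> K"]) (simp add: True algebra_simps)
    then show thesis
      using that[OF a(1) b(1)] by blast
  next
    case False
    then obtain m where m: "d = int m + 2"
      using \<open>d \<ge> 1\<close> that[of "nat (d - 2)"] by simp
    let ?v = "[f a, g b] @ alternating (\<lambda>_. f eA) (\<lambda>_. g eB) m"
    have "k + l - signed_sum ?v \<in> K"
      using sum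
      by (rule back_subst[of "\<lambda>k. k \<in> K"])
        (intro poly_mapping_eqI,
          simp add: signed_sum_alternating_const m lookup_add lookup_minus algebra_simps)
    then show thesis
      using that[OF a(1) b(1)] by blast
  qed
qed


section \<open>Normal forms in the direct sum\<close>

lemma sym_word_singleton: "prune (sym_word [x]) = sym_word [x]"
  by (intro prune_sym_word_reduced) (simp add: reduced_sym_word_iff)

lemma bracket_letters:
  assumes "x \<in> X" "y \<in> X" "z \<in> X" "t \<in> X" "w \<in> odd_words X"
  defines "F \<equiv> free_heap X"
  shows "bracket F (bracket F (sym_word [x]) (sym_word [y]) (sym_word [z])) (sym_word [t])
      (prune (sym_word w)) = prune (sym_word ([x, y, z] @ [t] @ w))"
proof -
  have "[x] \<in> odd_words X" "[y] \<in> odd_words X" "[z] \<in> odd_words X" "[t] \<in> odd_words X"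
    "[x, y, z] \<in> odd_words X"
    using assms by (auto simp: odd_words_def)
  then show ?thesis
    using assms(5) bracket_free_heap[of "[x]" X "[y]" "[z]"] bracket_free_heap[of "[x, y, z]" X "[t]" w]
    by (simp add: F_def sym_word_singleton)
qed

text \<open>The data of the direct sum, with the base element of the free Abelian heap given by a word
  \<open>w0\<close>. That such a word exists means that the two heaps are not both empty.\<close>

locale heap_direct_sum = A: heap A + B: heap B
  for A :: "('a, 'm) ternary_scheme" and B :: "('b, 'n) ternary_scheme" +
  fixes w0 :: "('a + 'b) list"
  assumes w0: "w0 \<in> odd_words (carrier A <+> carrier B)"
begin

abbreviation "letters \<equiv> carrier A <+> carrier B"
abbreviation "base \<equiv> prune (sym_word w0)"
abbreviation "relator_heap \<equiv> sum_subheap A B base"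

lemma sum_relators_eq:
  "sum_relators A B base =
    {prune (sym_word ([Inl a, Inl a', Inl a''] @ [Inl (bracket A a a' a'')] @ w0))
      | a a' a''. a \<in> carrier A \<and> a' \<in> carrier A \<and> a'' \<in> carrier A}
    \<union> {prune (sym_word ([Inr b, Inr b', Inr b''] @ [Inr (bracket B b b' b'')] @ w0))
      | b b' b''. b \<in> carrier B \<and> b' \<in> carrier B \<and> b'' \<in> carrier B}"
proof -
  have "bracket (free_heap letters)
      (bracket (free_heap letters) (sym_word [Inl a]) (sym_word [Inl a']) (sym_word [Inl a'']))
      (sym_word [Inl (bracket A a a' a'')]) base =
      prune (sym_word ([Inl a, Inl a', Inl a''] @ [Inl (bracket A a a' a'')] @ w0))"
    if "a \<in> carrier A" "a' \<in> carrier A" "a'' \<in> carrier A" for a a' a''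
    using that w0 A.bracket_closed by (intro bracket_letters) auto
  moreover have "bracket (free_heap letters)
      (bracket (free_heap letters) (sym_word [Inr b]) (sym_word [Inr b']) (sym_word [Inr b'']))
      (sym_word [Inr (bracket B b b' b'')]) base =
      prune (sym_word ([Inr b, Inr b', Inr b''] @ [Inr (bracket B b b' b'')] @ w0))"
    if "b \<in> carrier B" "b' \<in> carrier B" "b'' \<in> carrier B" for b b' b''
    using that w0 B.bracket_closed by (intro bracket_letters) auto
  ultimately show ?thesis
    unfolding sum_relators_def Let_def by (intro arg_cong2[where f = "(\<union>)"] Collect_cong) metis+
qed

lemma sum_relators_subset: "sum_relators A B base \<subseteq> carrier (free_heap letters)"
proof -
  have "[Inl a, Inl a', Inl a''] @ [Inl (bracket A a a' a'')] @ w0 \<in> odd_words letters"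
    if "a \<in> carrier A" "a' \<in> carrier A" "a'' \<in> carrier A" for a a' a''
    using that w0 A.bracket_closed by (auto simp: odd_words_def)
  moreover have "[Inr b, Inr b', Inr b''] @ [Inr (bracket B b b' b'')] @ w0 \<in> odd_words letters"
    if "b \<in> carrier B" "b' \<in> carrier B" "b'' \<in> carrier B" for b b' b''
    using that w0 B.bracket_closed by (auto simp: odd_words_def)
  ultimately show ?thesis
    unfolding sum_relators_eq carrier_free_heap by blast
qed

lemma relators_in_relator_heap: "sum_relators A B base \<subseteq> relator_heap"
  unfolding sum_subheap_def by (rule hull_subset)

text \<open>The base element is itself a relator, namely the one of the identity \<open>[x, x, x] = x\<close>.\<close>

lemma base_in_relator_heap: "base \<in> relator_heap"
proof -
  obtain x where x: "x \<in> letters"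
    using w0 by (cases w0) (auto simp: odd_words_def)
  have cancel: "prune (sym_word ([x, x, x] @ [x] @ w0)) = base"
    by (intro prune_sym_word_eqI) simp
  have "base \<in> sum_relators A B base"
  proof (cases x)
    case (Inl a)
    then have "a \<in> carrier A" "bracket A a a a = a"
      using x A.bracket_left_cancel by auto
    then show ?thesis
      unfolding sum_relators_eq using cancel Inl by (intro UnI1 CollectI exI[of _ a]) simp
  next
    case (Inr b)
    then have "b \<in> carrier B" "bracket B b b b = b"
      using x B.bracket_left_cancel by auto
    then show ?thesis
      unfolding sum_relators_eq using cancel Inr by (intro UnI2 CollectI exI[of _ b]) simp
  qed
  then show ?thesis
    using relators_in_relator_heap by blast
qed

sublocale subheap_quotient letters relator_heap
proof
  show "subheap (free_heap letters) relator_heap"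
    unfolding sum_subheap_def by (rule subheap_hull[OF heap_free_heap sum_relators_subset])
  show "relator_heap \<noteq> {}"
    using base_in_relator_heap by blast
qed

lemma letter_relation:
  assumes "prune (sym_word ([x, y, z] @ [t] @ w0)) \<in> relator_heap" "{x, y, z, t} \<subseteq> letters"
  shows "frag_of x - frag_of y + frag_of z - frag_of t \<in> relations"
proof -
  have "signed_sum [x, y, z] - signed_sum [t] \<in> relations"
    using assms w0 base_in_relator_heap
    by (intro signed_sum_relation[of _ _ w0]) (auto simp: odd_words_def)
  then show ?thesis
    by (simp add: algebra_simps)
qed

lemma presentation_Inl: "heap_presentation A Inl relations"
proof
  fix a b c
  assume "a \<in> carrier A" "b \<in> carrier A" "c \<in> carrier A"
  moreover from this have "prune (sym_word ([Inl a, Inl b, Inl c] @ [Inl (bracket A a b c)] @ w0))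
      \<in> relator_heap"
    using relators_in_relator_heap unfolding sum_relators_eq by blast
  ultimately show "frag_of (Inl a) - frag_of (Inl b) + frag_of (Inl c) - frag_of (Inl (bracket A a b c))
      \<in> relations"
    using A.bracket_closed by (intro letter_relation) auto
qed (rule zero_relation, erule uminus_relation, erule (1) add_relation)

lemma presentation_Inr: "heap_presentation B Inr relations"
proof
  fix a b c
  assume "a \<in> carrier B" "b \<in> carrier B" "c \<in> carrier B"
  moreover from this have "prune (sym_word ([Inr a, Inr b, Inr c] @ [Inr (bracket B a b c)] @ w0))
      \<in> relator_heap"
    using relators_in_relator_heap unfolding sum_relators_eq by blast
  ultimately show "frag_of (Inr a) - frag_of (Inr b) + frag_of (Inr c) - frag_of (Inr (bracket B a b c))
      \<in> relations"
    using B.bracket_closed by (intro letter_relation) auto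
qed (rule zero_relation, erule uminus_relation, erule (1) add_relation)

lemma word_class_eqI:
  assumes "u \<in> odd_words letters" "v \<in> odd_words letters" "signed_sum u - signed_sum v \<in> relations"
  shows "word_class A B base u = word_class A B base v"
  unfolding word_class_def using class_eqI[OF assms] .

lemma standard_words_odd:
  assumes "eA \<in> carrier A" "eB \<in> carrier B"
  shows "standard_words (carrier A) (carrier B) eA eB \<subseteq> odd_words letters"
  using assms by (auto simp: standard_words_def odd_words_def set_alternating length_alternating)

lemma special_words_odd:
  "three_letter_words (carrier A) (carrier B) \<union> alternating_words (carrier A) (carrier B)
    \<subseteq> odd_words letters"
  by (auto simp: three_letter_words_def alternating_words_def odd_words_def set_alternating
      length_alternating)

lemma standard_word_exists:
  assumes e: "eA \<in> carrier A" "eB \<in> carrier B" and w: "w \<in> odd_words letters"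
  shows "\<exists>v \<in> standard_words (carrier A) (carrier B) eA eB.
    word_class A B base w = word_class A B base v"
proof -
  note pres = presentation_Inl presentation_Inr
  have "set w \<subseteq> Inl ` carrier A \<union> Inr ` carrier B" "odd (length w)"
    using w by (auto simp: odd_words_def)
  then obtain k l d where kl: "signed_sum w = k + l"
      "k \<in> heap_presentation.degree_part A Inl relations eA d"
      "l \<in> heap_presentation.degree_part B Inr relations eB (1 - d)"
    using signed_sum_split[OF pres e, of w] by (simp, blast)
  have "\<exists>v \<in> standard_words (carrier A) (carrier B) eA eB.
      signed_sum w - signed_sum v \<in> relations"
  proof (cases "d \<ge> 1")
    case True
    obtain a b v where v: "a \<in> carrier A" "b \<in> carrier B" "k + l - signed_sum v \<in> relations"
        "v = [Inl a, Inr b, Inr eB] \<or>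
          (\<exists>m. v = [Inl a, Inr b] @ alternating (\<lambda>_. Inl eA) (\<lambda>_. Inr eB) m)"
      by (rule standard_form_pos_degree[OF pres e kl(2,3) True])
    then have "v \<in> standard_words (carrier A) (carrier B) eA eB"
      unfolding standard_words_def by blast
    then show ?thesis
      using v(3) kl(1) by auto
  next
    case False
    then have d: "1 - d \<ge> 1"
      and k: "k \<in> heap_presentation.degree_part A Inl relations eA (1 - (1 - d))"
      using kl(2) by auto
    obtain b a v where v: "b \<in> carrier B" "a \<in> carrier A" "l + k - signed_sum v \<in> relations"
        "v = [Inr b, Inl a, Inl eA] \<or>
          (\<exists>m. v = [Inr b, Inl a] @ alternating (\<lambda>_. Inr eB) (\<lambda>_. Inl eA) m)"
      by (rule standard_form_pos_degree[OF pres(2,1) e(2,1) kl(3) k d])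
    then have "v \<in> standard_words (carrier A) (carrier B) eA eB"
      unfolding standard_words_def by blast
    then show ?thesis
      using v(3) kl(1) by (auto simp: add.commute)
  qed
  then show ?thesis
    using word_class_eqI[OF w] standard_words_odd[OF e] by blast
qed

text \<open>The standard words are three-letter or alternating words, except that \<open>\<langle>a b e\<^sub>B\<rangle>\<close> and
  \<open>\<langle>b a e\<^sub>A\<rangle>\<close> degenerate to one letter when \<open>b = e\<^sub>B\<close> and \<open>a = e\<^sub>A\<close>, and that
  \<open>\<langle>b a e\<^sub>A\<rangle>\<close> has to be reordered to \<open>\<langle>e\<^sub>A a b\<rangle>\<close>.\<close>

lemma standard_word_reduction:
  assumes e: "eA \<in> carrier A" "eB \<in> carrier B"
    and v: "v \<in> standard_words (carrier A) (carrier B) eA eB"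
  shows "\<exists>w \<in> one_letter_words (carrier A) (carrier B) \<union> three_letter_words (carrier A) (carrier B)
      \<union> alternating_words (carrier A) (carrier B). word_class A B base v = word_class A B base w"
proof -
  have same: "word_class A B base u = word_class A B base w"
    if "u \<in> odd_words letters" "w \<in> odd_words letters" "signed_sum u = signed_sum w" for u w
    using word_class_eqI[OF that(1,2)] that(3) zero_relation by simp
  consider
    a b where "v = [Inl a, Inr b, Inr eB]" "a \<in> carrier A" "b \<in> carrier B"
    | a b where "v = [Inr b, Inl a, Inl eA]" "a \<in> carrier A" "b \<in> carrier B"
    | a b m where "v = [Inl a, Inr b] @ alternating (\<lambda>_. Inl eA) (\<lambda>_. Inr eB) m"
      "a \<in> carrier A" "b \<in> carrier B"
    | a b m where "v = [Inr b, Inl a] @ alternating (\<lambda>_. Inr eB) (\<lambda>_. Inl eA) m"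
      "a \<in> carrier A" "b \<in> carrier B"
    using v unfolding standard_words_def by blast
  then show ?thesis
  proof cases
    case 1
    show ?thesis
    proof (cases "b = eB")
      case True
      have "word_class A B base v = word_class A B base [Inl a]"
        using 1 True by (intro same) (auto simp: odd_words_def)
      then show ?thesis
        using 1 by (intro bexI[of _ "[Inl a]"]) (auto simp: one_letter_words_def)
    next
      case False
      then show ?thesis
        using 1 e by (intro bexI[of _ v]) (auto simp: three_letter_words_def)
    qed
  next
    case 2
    show ?thesis
    proof (cases "a = eA")
      case True
      have "word_class A B base v = word_class A B base [Inr b]"
        using 2 True by (intro same) (auto simp: odd_words_def)
      then show ?thesis
        using 2 by (intro bexI[of _ "[Inr b]"]) (auto simp: one_letter_words_def)
    next
      case False
      have "word_class A B base v = word_class A B base [Inl eA, Inl a, Inr b]"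
        using 2 e by (intro same) (auto simp: odd_words_def)
      then show ?thesis
        using 2 e False
        by (intro bexI[of _ "[Inl eA, Inl a, Inr b]"]) (auto simp: three_letter_words_def)
    qed
  next
    case 3
    have "v = alternating (\<lambda>i. Inl (if i = 1 then a else eA))
        (\<lambda>i. Inr (if i = 1 then b else eB)) (Suc m)"
      unfolding 3(1) Cons_Cons_alternating by (auto intro!: alternating_cong)
    then have "v \<in> alternating_words (carrier A) (carrier B)"
      unfolding alternating_words_def
      by (intro UnI1 CollectI exI conjI) (use 3 e in auto)
    then show ?thesis
      by blast
  next
    case 4
    have "v = alternating (\<lambda>i. Inr (if i = 1 then b else eB))
        (\<lambda>i. Inl (if i = 1 then a else eA)) (Suc m)"
      unfolding 4(1) Cons_Cons_alternating by (auto intro!: alternating_cong)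
    then have "v \<in> alternating_words (carrier A) (carrier B)"
      unfolding alternating_words_def
      by (intro UnI2 CollectI exI conjI) (use 4 e in auto)
    then show ?thesis
      by blast
  qed
qed

lemma one_letter_word_exists:
  assumes empty: "carrier A = {} \<or> carrier B = {}" and w: "w \<in> odd_words letters"
  shows "\<exists>u \<in> one_letter_words (carrier A) (carrier B).
    word_class A B base w = word_class A B base u"
proof (cases "carrier B = {}")
  case True
  then have "set w \<subseteq> Inl ` carrier A" "odd (length w)"
    using w by (auto simp: odd_words_def)
  then obtain a where "a \<in> carrier A" "signed_sum w - frag_of (Inl a) \<in> relations"
    using heap_presentation.odd_word_degree_part[OF presentation_Inl] by metis
  then show ?thesis
    using word_class_eqI[OF w, of "[Inl a]"] by (auto simp: one_letter_words_def odd_words_def)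
next
  case False
  then have "set w \<subseteq> Inr ` carrier B" "odd (length w)"
    using w empty by (auto simp: odd_words_def)
  then obtain b where "b \<in> carrier B" "signed_sum w - frag_of (Inr b) \<in> relations"
    using heap_presentation.odd_word_degree_part[OF presentation_Inr] by metis
  then show ?thesis
    using word_class_eqI[OF w, of "[Inr b]"] by (auto simp: one_letter_words_def odd_words_def)
qed

lemma carrier_direct_sum: "carrier (direct_sum A B base) = word_class A B base ` odd_words letters"
proof -
  have "carrier A \<noteq> {} \<or> carrier B \<noteq> {}"
    using w0 by (cases w0) (auto simp: odd_words_def)
  then show ?thesis
    by (auto simp: direct_sum_def quotient_heap_def quotient_def word_class_def carrier_free_heap)
qed

lemma word_class_forms:
  assumes "w \<in> odd_words letters"
  shows "\<exists>u \<in> one_letter_words (carrier A) (carrier B) \<union> three_letter_words (carrier A) (carrier B)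
      \<union> alternating_words (carrier A) (carrier B). word_class A B base w = word_class A B base u"
proof (cases "carrier A = {} \<or> carrier B = {}")
  case True
  then show ?thesis
    using one_letter_word_exists[OF _ assms] by blast
next
  case False
  then obtain eA eB where "eA \<in> carrier A" "eB \<in> carrier B"
    by blast
  then show ?thesis
    using standard_word_exists[OF _ _ assms] standard_word_reduction by metis
qed

end

theorem proposition3p6:
  fixes A :: "('a, 'm) ternary_scheme" and B :: "('b, 'n) ternary_scheme"
    and e :: "('a + 'b) list set"
  assumes "abelian_heap A" and "abelian_heap B"
    and "carrier A \<noteq> {} \<or> carrier B \<noteq> {} \<Longrightarrow> e \<in> carrier (free_heap (carrier A <+> carrier B))"
  shows "(\<forall>z \<in> carrier (direct_sum A B e).
            \<exists>w \<in> one_letter_words (carrier A) (carrier B)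
                \<union> three_letter_words (carrier A) (carrier B)
                \<union> alternating_words (carrier A) (carrier B).
              z = word_class A B e w)
       \<and> (\<forall>eA \<in> carrier A. \<forall>eB \<in> carrier B.
            \<forall>w \<in> three_letter_words (carrier A) (carrier B)
                \<union> alternating_words (carrier A) (carrier B).
              \<exists>v \<in> standard_words (carrier A) (carrier B) eA eB.
                word_class A B e w = word_class A B e v)"
proof (cases "carrier A = {} \<and> carrier B = {}")
  case True
  then show ?thesis
    by (simp add: direct_sum_def)
next
  case False
  then obtain w0 where base_eq: "e = prune (sym_word w0)"
    and w0_odd: "w0 \<in> odd_words (carrier A <+> carrier B)"
    using assms(3) unfolding carrier_free_heap by blast
  interpret heap_direct_sum A B w0
    using assms(1,2) w0_odd
    by (simp add: heap_direct_sum_def heap_direct_sum_axioms_def abelian_heap_def)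
  show ?thesis
    unfolding base_eq carrier_direct_sum
    using word_class_forms standard_word_exists special_words_odd by blast
qed

end
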